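(* Let $f=[f^L,f^U]\colon\mathbb{R}^n\to\mathcal{K}_c$ be an interval-valued function with $f^L,f^U\colon\mathbb{R}^n\to\mathbb{R}$ convex, let $g_j\colon\mathbb{R}^n\to\mathbb{R}$, $j\in J:=\{1,\dots,m\}$, be convex, and let $X=\{x\in\mathbb{R}^n : g_j(x)\le 0,\ j\in J\}$. Let $\mathcal{E}=[\epsilon^L,\epsilon^U]$ with $0\le\epsilon^L\le\epsilon^U$, and let $x^*\in X$. Assume that the Mangasarian--Fromovitz constraint qualification $(MFCQ)$ holds at $x^*$. Then $x^*$ is a weakly $\mathcal{E}$-quasi-$LU$-solution of the problem of minimizing $f$ over $X$ if and only if there exist $\mu^L\ge0$, $\mu^U\ge0$ with $\mu^L+\mu^U>0$, and $\lambda_j\ge0$, $j\in J$, such that $$0\in\mu^L\partial f^L(x^* )+\mu^U\partial f^U(x^* )+\sum_{j=1}^m\lambda_j\partial g_j(x^* )+(\mu^L\epsilon^U+\mu^U\epsilon^L)B_{\mathbb{R}^n},\qquad \lambda_jg_j(x^* )=0\ \ \forall j\in J.$$ Furthermore, if $f^L$ and $f^U$ are strictly convex, then the existence of such $\mu^L,\mu^U,\lambda_j$ is also sufficient for $x^*$ to be an $\mathcal{E}$-quasi-$LU$-solution of the problem of minimizing $f$ over $X$.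
   Context: $\mathcal{K}_c$ is the set of all closed bounded intervals $[a^L,a^U]\subset\mathbb{R}$, $a^L\le a^U$. An interval-valued function is $f(x)=[f^L(x),f^U(x)]$ with $f^L(x)\le f^U(x)$ for all $x$. Interval arithmetic: $[a^L,a^U]-[b^L,b^U]=[a^L-b^U,\,a^U-b^L]$, and $k[a^L,a^U]=[ka^L,ka^U]$ for real $k\ge0$. $\|\cdot\|$ is the Euclidean norm and $B_{\mathbb{R}^n}$ the closed Euclidean unit ball centered at $0$. Order: $[a^L,a^U]\preceq_{LU}[b^L,b^U]$ iff $a^L\le b^L$ and $a^U\le b^U$; $A\prec_{LU}B$ iff $A\preceq_{LU}B$ and $A\ne B$; $[a^L,a^U]\prec^s_{LU}[b^L,b^U]$ iff $a^L<b^L$ and $a^U<b^U$. For $x^*\in X$: $x^*$ is an $\mathcal{E}$-quasi-$LU$-solution if there is no $x\in X$ with $f(x)\prec_{LU}f(x^* )-\mathcal{E}\|x-x^*\|$; $x^*$ is a weakly $\mathcal{E}$-quasi-$LU$-solution if there is no $x\in X$ with $f(x)\prec^s_{LU}f(x^* )-\mathcal{E}\|x-x^*\|$. $\partial\varphi(x^* )=\{v\in\mathbb{R}^n : \varphi(x)-\varphi(x^* )\ge\langle v,x-x^*\rangle\ \forall x\in\mathbb{R}^n\}$ is the convex subdifferential. $(MFCQ)$ holds at $x^*\in X$ if there do not exist $\lambda_j\ge0$, $j\in J(x^* )$, not all zero, such that $0\in\sum_{j\in J(x^* )}\lambda_j\partial g_j(x^* )$, where $J(x^* ):=\{j\in J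 : g_j(x^* )=0\}$. *)

theory Defs
  imports "HOL-Analysis.Analysis" "HOL-Library.Interval"
begin

text \<open>
  Closed bounded real intervals are the elements of \<^typ>\<open>real interval\<close>, whose subtraction is
  endpoint-wise, $[a^L, a^U] - [b^L, b^U] = [a^L - b^U, a^U - b^L]$. The orders \<open>\<le>\<close> and \<open><\<close> on
  that type are inclusion of intervals, hence the separate LU orders below. A scalar multiple of
  an interval is written \<open>interval_of k * A\<close>; the following two facts confirm that for
  nonnegative \<open>k\<close> this is $[k a^L, k a^U]$.
\<close>

lemma lower_scale: "0 \<le> k \<Longrightarrow> lower (interval_of k * A) = k * lower (A :: real interval)"
  by (simp add: lower_times mult_left_mono min_def)

lemma upper_scale: "0 \<le> k \<Longrightarrow> upper (interval_of k * A) = k * upper (A :: real interval)"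
  by (simp add: upper_times mult_left_mono max_def)

definition LU_le :: "real interval \<Rightarrow> real interval \<Rightarrow> bool"  (infix \<open>\<preceq>\<^sub>L\<^sub>U\<close> 50)
  where "A \<preceq>\<^sub>L\<^sub>U B \<longleftrightarrow> lower A \<le> lower B \<and> upper A \<le> upper B"

definition LU_less :: "real interval \<Rightarrow> real interval \<Rightarrow> bool"  (infix \<open>\<prec>\<^sub>L\<^sub>U\<close> 50)
  where "A \<prec>\<^sub>L\<^sub>U B \<longleftrightarrow> A \<preceq>\<^sub>L\<^sub>U B \<and> A \<noteq> B"

definition LU_sless :: "real interval \<Rightarrow> real interval \<Rightarrow> bool"  (infix \<open>\<prec>\<^sup>s\<^sub>L\<^sub>U\<close> 50)
  where "A \<prec>\<^sup>s\<^sub>L\<^sub>U B \<longleftrightarrow> lower A < lower B \<and> upper A < upper B"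

definition quasi_LU_solution ::
  "real interval \<Rightarrow> ('a::real_normed_vector \<Rightarrow> real interval) \<Rightarrow> 'a set \<Rightarrow> 'a \<Rightarrow> bool"
  where "quasi_LU_solution E f X xs \<longleftrightarrow>
    xs \<in> X \<and> \<not> (\<exists>x\<in>X. f x \<prec>\<^sub>L\<^sub>U f xs - interval_of (norm (x - xs)) * E)"

definition weakly_quasi_LU_solution ::
  "real interval \<Rightarrow> ('a::real_normed_vector \<Rightarrow> real interval) \<Rightarrow> 'a set \<Rightarrow> 'a \<Rightarrow> bool"
  where "weakly_quasi_LU_solution E f X xs \<longleftrightarrow>
    xs \<in> X \<and> \<not> (\<exists>x\<in>X. f x \<prec>\<^sup>s\<^sub>L\<^sub>U f xs - interval_of (norm (x - xs)) * E)"

definition subdifferential :: "('a::real_inner \<Rightarrow> real) \<Rightarrow> 'a \<Rightarrow> 'a set"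
  where "subdifferential \<phi> xs = {v. \<forall>x. \<phi> x - \<phi> xs \<ge> v \<bullet> (x - xs)}"

definition strictly_convex_on :: "'a::real_vector set \<Rightarrow> ('a \<Rightarrow> real) \<Rightarrow> bool"
  where "strictly_convex_on S \<phi> \<longleftrightarrow> convex S \<and>
    (\<forall>x\<in>S. \<forall>y\<in>S. x \<noteq> y \<longrightarrow>
      (\<forall>u>0. \<forall>v>0. u + v = 1 \<longrightarrow> \<phi> (u *\<^sub>R x + v *\<^sub>R y) < u * \<phi> x + v * \<phi> y))"

definition feasible_set :: "nat \<Rightarrow> (nat \<Rightarrow> 'a \<Rightarrow> real) \<Rightarrow> 'a set"
  where "feasible_set m g = {x. \<forall>j\<in>{1..m}. g j x \<le> 0}"

definition active_indices :: "nat \<Rightarrow> (nat \<Rightarrow> 'a \<Rightarrow> real) \<Rightarrow> 'a \<Rightarrow> nat set"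
  where "active_indices m g xs = {j \<in> {1..m}. g j xs = 0}"

text \<open>
  Below, \<open>+\<close> and \<open>\<Sum>\<close> on sets of vectors are Minkowski sums (the empty one being \<open>{0}\<close>), and
  \<open>(*\<^sub>R) c ` S\<close> is the dilation of \<open>S\<close> by \<open>c\<close>.
\<close>

definition MFCQ :: "nat \<Rightarrow> (nat \<Rightarrow> 'a::real_inner \<Rightarrow> real) \<Rightarrow> 'a \<Rightarrow> bool"
  where "MFCQ m g xs \<longleftrightarrow>
    \<not> (\<exists>lam::nat \<Rightarrow> real.
        (\<forall>j\<in>active_indices m g xs. lam j \<ge> 0) \<and>
        (\<exists>j\<in>active_indices m g xs. lam j \<noteq> 0) \<and>
        0 \<in> (\<Sum>j\<in>active_indices m g xs. (*\<^sub>R) (lam j) ` subdifferential (g j) xs))"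

definition KKT_multipliers ::
  "real interval \<Rightarrow> ('a::real_inner \<Rightarrow> real interval) \<Rightarrow> nat \<Rightarrow> (nat \<Rightarrow> 'a \<Rightarrow> real) \<Rightarrow> 'a \<Rightarrow>
    real \<Rightarrow> real \<Rightarrow> (nat \<Rightarrow> real) \<Rightarrow> bool"
  where "KKT_multipliers E f m g xs \<mu>L \<mu>U lam \<longleftrightarrow>
    \<mu>L \<ge> 0 \<and> \<mu>U \<ge> 0 \<and> \<mu>L + \<mu>U > 0 \<and> (\<forall>j\<in>{1..m}. lam j \<ge> 0) \<and>
    0 \<in> (*\<^sub>R) \<mu>L ` subdifferential (\<lambda>x. lower (f x)) xs
        + (*\<^sub>R) \<mu>U ` subdifferential (\<lambda>x. upper (f x)) xs
        + (\<Sum>j=1..m. (*\<^sub>R) (lam j) ` subdifferential (g j) xs)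
        + (*\<^sub>R) (\<mu>L * upper E + \<mu>U * lower E) ` cball 0 1 \<and>
    (\<forall>j\<in>{1..m}. lam j * g j xs = 0)"

end

theory Submission
  imports Defs
begin

text \<open>
  Put \<open>\<phi>\<^sup>L x = f\<^sup>L x - f\<^sup>L x\<^sup>* + \<epsilon>\<^sup>U \<parallel>x - x\<^sup>*\<parallel>\<close> and
  \<open>\<phi>\<^sup>U x = f\<^sup>U x - f\<^sup>U x\<^sup>* + \<epsilon>\<^sup>L \<parallel>x - x\<^sup>*\<parallel>\<close>; both are convex and vanish at \<open>x\<^sup>*\<close>, and weak
  optimality says that no feasible point makes both negative. By Fan's theorem of the alternative
  some nontrivial nonnegative combination of \<open>\<phi>\<^sup>L\<close>, \<open>\<phi>\<^sup>U\<close> and the \<open>g\<^sub>j\<close> is nonnegative everywhere.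
  Evaluation at \<open>x\<^sup>*\<close> gives complementary slackness, so \<open>x\<^sup>*\<close> minimises the combination and the
  subdifferential sum rule gives the inclusion; MFCQ excludes \<open>\<mu>\<^sup>L = \<mu>\<^sup>U = 0\<close>. The converse adds up
  the subgradient inequalities. Under strict convexity, if \<open>x\<close> violates optimality, then the
  midpoint of \<open>x\<close> and \<open>x\<^sup>*\<close> violates weak optimality.
\<close>

section \<open>Subdifferentials of finite convex functions\<close>

text \<open>For negative \<open>b\<close> the right side would tend to minus infinity. This reads
  off the sign of a separating normal from a set that is unbounded upwards.\<close>

lemma nonneg_slope:
  fixes b c t0 :: real
  assumes "\<And>t. t0 < t \<Longrightarrow> c \<le> b * t"
  shows "0 \<le> b"
proof (rule ccontr)
  assume "\<not> 0 \<le> b"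
  define t where "t = max (t0 + 1) ((c - 1) / b)"
  have "t0 < t" by (auto simp: t_def)
  have "b * t \<le> b * ((c - 1) / b)"
    using \<open>\<not> 0 \<le> b\<close> by (intro mult_left_mono_neg) (auto simp: t_def)
  with assms[OF \<open>t0 < t\<close>] \<open>\<not> 0 \<le> b\<close> show False by simp
qed

text \<open>The strict epigraph of \<open>p\<close> and the hypograph of \<open>- q\<close> over
  \<open>C\<close> are disjoint convex sets. A hyperplane separating them cannot be vertical, as
  \<open>p\<close> is finite everywhere, so it is the graph of an affine function. A singleton
  \<open>C\<close> yields subgradients, and the whole space yields the sum rule.\<close>

lemma convex_on_affine_separation:
  fixes p q :: "'a::euclidean_space \<Rightarrow> real"
  assumes p: "convex_on UNIV p" and q: "convex_on C q" and "C \<noteq> {}"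
    and nonneg: "\<And>x. x \<in> C \<Longrightarrow> 0 \<le> p x + q x"
  obtains v c where "\<And>x. v \<bullet> x + c \<le> p x" and "\<And>x. x \<in> C \<Longrightarrow> - q x \<le> v \<bullet> x + c"
proof -
  define S where "S = {(x, t). p x < t}"
  define T where "T = {(x, t). x \<in> C \<and> t \<le> - q x}"
  have "convex S"
  proof (rule convexI)
    fix y z :: "'a \<times> real" and u v :: real
    assume *: "y \<in> S" "z \<in> S" "0 \<le> u" "0 \<le> v" "u + v = 1"
    obtain y1 y2 z1 z2 where [simp]: "y = (y1, y2)" "z = (z1, z2)"
      by (metis surj_pair)
    have "p (u *\<^sub>R y1 + v *\<^sub>R z1) \<le> u * p y1 + v * p z1"
      using p * by (auto simp: convex_on_def)
    also have "\<dots> < u * y2 + v * z2"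
    \<comment> \<open>For \<open>u = 0\<close> we have \<open>v = 1\<close>, and the second term
      provides the strict inequality; otherwise the first one does.\<close>
    proof (cases "u = 0")
      case True
      with * show ?thesis by (simp add: S_def)
    next
      case False
      with * show ?thesis
        by (intro add_less_le_mono mult_strict_left_mono mult_left_mono) (auto simp: S_def)
    qed
    finally show "u *\<^sub>R y + v *\<^sub>R z \<in> S" by (simp add: S_def)
  qed
  moreover have "convex T"
  proof (rule convexI)
    fix y z :: "'a \<times> real" and u v :: real
    assume *: "y \<in> T" "z \<in> T" "0 \<le> u" "0 \<le> v" "u + v = 1"
    obtain y1 y2 z1 z2 where [simp]: "y = (y1, y2)" "z = (z1, z2)"
      by (metis surj_pair)
    have "u * y2 + v * z2 \<le> u * (- q y1) + v * (- q z1)"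
      using * by (intro add_mono mult_left_mono) (auto simp: T_def)
    moreover have "q (u *\<^sub>R y1 + v *\<^sub>R z1) \<le> u * q y1 + v * q z1"
      using q * by (auto simp: convex_on_def T_def)
    moreover have "u *\<^sub>R y1 + v *\<^sub>R z1 \<in> C"
      using convex_on_imp_convex[OF q] * by (auto simp: T_def intro: convexD)
    ultimately show "u *\<^sub>R y + v *\<^sub>R z \<in> T" by (simp add: T_def)
  qed
  moreover have "S \<noteq> {}"
    by (auto simp: S_def intro: gt_ex)
  moreover have "T \<noteq> {}"
    using \<open>C \<noteq> {}\<close> by (auto simp: T_def)
  moreover have "S \<inter> T = {}"
    using nonneg by (force simp: S_def T_def)
  ultimately obtain ab \<beta> where "ab \<noteq> 0"
    and T_le: "\<And>y. y \<in> T \<Longrightarrow> ab \<bullet> y \<le> \<beta>" and S_ge: "\<And>y. y \<in> S \<Longrightarrow> \<beta> \<le> ab \<bullet> y"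
    using separating_hyperplane_sets[of T S] by (metis Int_commute)
  obtain a b where [simp]: "ab = (a, b)" by (metis surj_pair)
  have above: "\<beta> \<le> a \<bullet> x + b * t" if "p x < t" for x t
    using S_ge[of "(x, t)"] that by (simp add: S_def)
  have "0 \<le> b"
    using above[of 0] by (intro nonneg_slope[of "p 0" \<beta>]) simp
  \<comment> \<open>With \<open>b = 0\<close>, the functional \<open>a\<close> would be bounded
    below by \<open>\<beta>\<close> on the whole space; the \<open>x\<close> below is chosen so that
    \<open>a \<bullet> x = \<beta> - 1\<close>.\<close>
  moreover have "b \<noteq> 0"
  proof
    assume "b = 0"
    with \<open>ab \<noteq> 0\<close> have "a \<noteq> 0" by (simp add: zero_prod_def)
    define x where "x = ((\<beta> - 1) / (a \<bullet> a)) *\<^sub>R a"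
    have "a \<bullet> x = \<beta> - 1" using \<open>a \<noteq> 0\<close> by (simp add: x_def)
    with above[of x "p x + 1"] \<open>b = 0\<close> show False by simp
  qed
  ultimately have "0 < b" by simp
  show ?thesis
  proof
    fix x
    \<comment> \<open>Solving the hyperplane equation for the last coordinate gives the affine
      function; density of the reals passes from the strict epigraph to the graph of
      \<open>p\<close>.\<close>
    have "(\<beta> - a \<bullet> x) / b \<le> p x"
    proof (rule dense_ge)
      fix t assume "p x < t"
      with above[of x t] \<open>0 < b\<close> show "(\<beta> - a \<bullet> x) / b \<le> t"
        by (simp add: field_simps)
    qed
    then show "(- (1 / b) *\<^sub>R a) \<bullet> x + \<beta> / b \<le> p x"
      by (simp add: diff_divide_distrib)
  next
    fix x assume "x \<in> C"
    then have "a \<bullet> x + b * (- q x) \<le> \<beta>"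
      using T_le[of "(x, - q x)"] by (simp add: T_def)
    then show "- q x \<le> (- (1 / b) *\<^sub>R a) \<bullet> x + \<beta> / b"
      using \<open>0 < b\<close> by (simp add: field_simps)
  qed
qed

text \<open>On the singleton \<open>{xs}\<close> even \<open>- p\<close> is convex, so separation
  yields an affine minorant of \<open>p\<close> that touches it at \<open>xs\<close>.\<close>

lemma subdifferential_nonempty:
  fixes p :: "'a::euclidean_space \<Rightarrow> real"
  assumes "convex_on UNIV p"
  shows "subdifferential p xs \<noteq> {}"
proof -
  have "convex_on {xs} (\<lambda>x. - p x)"
    by (intro convex_onI) (auto simp: algebra_simps)
  then obtain v c where "\<And>x. v \<bullet> x + c \<le> p x" "p xs \<le> v \<bullet> xs + c"
    using convex_on_affine_separation[OF assms, of "{xs}" "\<lambda>x. - p x"] by auto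
  then have "v \<in> subdifferential p xs"
    by (simp add: subdifferential_def inner_diff_right) (smt (verit))
  then show ?thesis by blast
qed

text \<open>Subtracting from \<open>q\<close> the affine minorant of \<open>p + q\<close> with slope
  \<open>w\<close> gives \<open>r\<close> with \<open>p + r\<close> nonnegative and zero at
  \<open>xs\<close>. An affine function between \<open>- r\<close> and \<open>p\<close> touches both
  at \<open>xs\<close>; its slope \<open>v\<close> is a subgradient of \<open>p\<close>, and
  \<open>w - v\<close> is one of \<open>q\<close>.\<close>

lemma subdifferential_add_subset:
  fixes p q :: "'a::euclidean_space \<Rightarrow> real"
  assumes p: "convex_on UNIV p" and q: "convex_on UNIV q"
  shows "subdifferential (\<lambda>x. p x + q x) xs \<subseteq> subdifferential p xs + subdifferential q xs"
proof
  fix w assume w: "w \<in> subdifferential (\<lambda>x. p x + q x) xs"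
  define r where "r x = q x + (- w \<bullet> (x - xs) - p xs - q xs)" for x
  have "convex_on UNIV (\<lambda>x. - w \<bullet> (x - xs) - p xs - q xs)"
  proof (intro convex_onI)
    fix t :: real and x y :: 'a
    show "- w \<bullet> ((1 - t) *\<^sub>R x + t *\<^sub>R y - xs) - p xs - q xs
      \<le> (1 - t) * (- w \<bullet> (x - xs) - p xs - q xs) + t * (- w \<bullet> (y - xs) - p xs - q xs)"
      by (simp add: algebra_simps)
  qed simp
  then have r: "convex_on UNIV r"
    unfolding r_def by (intro convex_on_add q)
  have "0 \<le> p x + r x" for x
    using w by (simp add: r_def subdifferential_def) (smt (verit))
  then obtain v c where v: "\<And>x. v \<bullet> x + c \<le> p x" "\<And>x. - r x \<le> v \<bullet> x + c"
    using convex_on_affine_separation[OF p r] by auto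
  have eq: "v \<bullet> xs + c = p xs"
    using v[of xs] by (simp add: r_def)
  have "v \<bullet> (x - xs) \<le> p x - p xs" for x
    using v(1)[of x] eq by (simp add: inner_diff_right)
  moreover have "(w - v) \<bullet> (x - xs) \<le> q x - q xs" for x
    using v(2)[of x] eq by (simp add: inner_diff_right inner_diff_left r_def)
  ultimately have "v + (w - v) \<in> subdifferential p xs + subdifferential q xs"
    by (intro set_plus_intro) (auto simp: subdifferential_def)
  then show "w \<in> subdifferential p xs + subdifferential q xs" by simp
qed

lemma subdifferential_const:
  "subdifferential (\<lambda>x. c) xs = {0}"
proof -
  have "v = 0" if "\<And>x. v \<bullet> (x - xs) \<le> 0" for v
    using that[of "xs + v"] by (simp flip: power2_norm_eq_inner)
  then show ?thesis by (auto simp: subdifferential_def)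
qed

lemma convex_on_sum_functions:
  fixes h :: "'i \<Rightarrow> 'a::real_vector \<Rightarrow> real"
  assumes "finite I" "convex S" "\<And>i. i \<in> I \<Longrightarrow> convex_on S (h i)"
  shows "convex_on S (\<lambda>x. \<Sum>i\<in>I. h i x)"
  using assms by (induction I rule: finite_induct) (auto simp: convex_on_const)

lemma subdifferential_sum_subset:
  fixes h :: "'i \<Rightarrow> 'a::euclidean_space \<Rightarrow> real"
  assumes "finite I" "\<And>i. i \<in> I \<Longrightarrow> convex_on UNIV (h i)"
  shows "subdifferential (\<lambda>x. \<Sum>i\<in>I. h i x) xs \<subseteq> (\<Sum>i\<in>I. subdifferential (h i) xs)"
  using assms
proof (induction I rule: finite_induct)
  case empty
  then show ?case by (simp add: subdifferential_const)
next
  case (insert i I)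
  have "convex_on UNIV (\<lambda>x. \<Sum>i\<in>I. h i x)"
    using insert by (intro convex_on_sum_functions) auto
  then have "subdifferential (\<lambda>x. h i x + (\<Sum>i\<in>I. h i x)) xs
      \<subseteq> subdifferential (h i) xs + subdifferential (\<lambda>x. \<Sum>i\<in>I. h i x) xs"
    using insert by (intro subdifferential_add_subset) auto
  also have "\<dots> \<subseteq> subdifferential (h i) xs + (\<Sum>i\<in>I. subdifferential (h i) xs)"
    using insert by (intro set_plus_mono2) auto
  finally show ?case using insert by simp
qed

text \<open>Positive \<open>c\<close> is divided out. For \<open>c = 0\<close> the left side is
  \<open>{0}\<close>, and the right side contains 0 because the subdifferential is nonempty.\<close>

lemma subdifferential_cmult_subset:
  fixes p :: "'a::euclidean_space \<Rightarrow> real"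
  assumes "convex_on UNIV p" "0 \<le> c"
  shows "subdifferential (\<lambda>x. c * p x) xs \<subseteq> (*\<^sub>R) c ` subdifferential p xs"
proof (cases "c = 0")
  case True
  then show ?thesis
    using subdifferential_nonempty[OF assms(1)] by (auto simp: subdifferential_const)
next
  case False
  show ?thesis
  proof
    fix v assume "v \<in> subdifferential (\<lambda>x. c * p x) xs"
    then have "(1 / c) *\<^sub>R v \<in> subdifferential p xs"
      using False \<open>0 \<le> c\<close> by (simp add: subdifferential_def field_simps)
    moreover have "v = c *\<^sub>R ((1 / c) *\<^sub>R v)" using False by simp
    ultimately show "v \<in> (*\<^sub>R) c ` subdifferential p xs" by blast
  qed
qed

text \<open>Testing a subgradient \<open>v\<close> in its own direction bounds its norm by
  \<open>c\<close>.\<close>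

lemma subdifferential_norm_subset:
  assumes "0 \<le> c"
  shows "subdifferential (\<lambda>x. c * norm (x - xs)) xs \<subseteq> (*\<^sub>R) c ` cball 0 1"
proof
  fix v assume v: "v \<in> subdifferential (\<lambda>x. c * norm (x - xs)) xs"
  have "v \<bullet> (x - xs) \<le> c * norm (x - xs)" for x
    using v by (simp add: subdifferential_def)
  from this[of "xs + v"] have "norm v * norm v \<le> c * norm v"
    by (simp add: power2_norm_eq_inner flip: power2_eq_square)
  then have "norm v \<le> c" using assms by (cases "v = 0") auto
  show "v \<in> (*\<^sub>R) c ` cball 0 1"
  proof (cases "c = 0")
    case True
    with \<open>norm v \<le> c\<close> show ?thesis by (auto intro!: image_eqI[of _ _ 0])
  next
    case False
    with \<open>norm v \<le> c\<close> \<open>0 \<le> c\<close> show ?thesis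
      by (intro image_eqI[of _ _ "(1 / c) *\<^sub>R v"]) auto
  qed
qed

section \<open>Fan's theorem of the alternative\<close>

text \<open>The pairs strictly above some \<open>(p x, q x)\<close> form a convex set that misses
  the origin. Separation takes place in the plane, so the domain may be any real vector space. The
  set is closed upwards, so the normal is nonnegative and can be scaled to weights of sum 1.\<close>

lemma convex_alternative_two:
  fixes p q :: "'a::real_vector \<Rightarrow> real"
  assumes p: "convex_on UNIV p" and q: "convex_on UNIV q"
    and nonneg: "\<And>x. 0 \<le> p x \<or> 0 \<le> q x"
  obtains s t where "0 \<le> s" "0 \<le> t" "s + t = 1" "\<And>x. 0 \<le> s * p x + t * q x"
proof -
  define S where "S = {(y, z). \<exists>x. p x < y \<and> q x < z}"
  have "convex S"
  proof (rule convexI)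
    fix y z :: "real \<times> real" and u v :: real
    assume *: "y \<in> S" "z \<in> S" "0 \<le> u" "0 \<le> v" "u + v = 1"
    obtain y1 y2 z1 z2 where [simp]: "y = (y1, y2)" "z = (z1, z2)"
      by (metis surj_pair)
    obtain a b where ab: "p a < y1" "q a < y2" "p b < z1" "q b < z2"
      using * by (auto simp: S_def)
    have comb: "r (u *\<^sub>R a + v *\<^sub>R b) < u * c + v * d"
      if "convex_on UNIV r" "r a < c" "r b < d" for r c d
    proof -
      have "r (u *\<^sub>R a + v *\<^sub>R b) \<le> u * r a + v * r b"
        using that * by (auto simp: convex_on_def)
      also have "\<dots> < u * c + v * d"
      proof (cases "u = 0")
        case True
        with * that show ?thesis by simp
      next
        case False
        with * that show ?thesis
          by (intro add_less_le_mono mult_strict_left_mono mult_left_mono) auto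
      qed
      finally show ?thesis .
    qed
    show "u *\<^sub>R y + v *\<^sub>R z \<in> S"
      using comb[OF p ab(1,3)] comb[OF q ab(2,4)] by (auto simp: S_def)
  qed
  moreover have "(0, 0) \<notin> S"
    unfolding S_def using nonneg by (simp add: not_less)
  ultimately obtain ab where "ab \<noteq> 0" and ab: "\<And>y. y \<in> S \<Longrightarrow> 0 \<le> ab \<bullet> y"
    using separating_hyperplane_set_0[of S] by (auto simp: zero_prod_def)
  obtain a b where [simp]: "ab = (a, b)" by (metis surj_pair)
  have above: "0 \<le> a * y + b * z" if "p x < y" "q x < z" for x y z
    using ab[of "(y, z)"] that by (auto simp: S_def)
  \<comment> \<open>The point \<open>(p x, q x)\<close> is only a limit of points of
    \<open>S\<close>: raise both coordinates by \<open>e\<close> and let \<open>e\<close> tend to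
    0.\<close>
  have nonneg_comb: "0 \<le> a * p x + b * q x" for x
  proof (rule tendsto_lowerbound)
    have "((\<lambda>e. a * (p x + e) + b * (q x + e)) \<longlongrightarrow> a * (p x + 0) + b * (q x + 0)) (at_right 0)"
      by (intro tendsto_intros)
    then show "((\<lambda>e. a * (p x + e) + b * (q x + e)) \<longlongrightarrow> a * p x + b * q x) (at_right 0)"
      by simp
    show "\<forall>\<^sub>F e in at_right 0. 0 \<le> a * (p x + e) + b * (q x + e)"
      using eventually_at_right_less[of 0] by eventually_elim (rule above[of x]; simp)
  qed simp
  have "0 \<le> a"
  proof (rule nonneg_slope)
    show "- (b * (q 0 + 1)) \<le> a * y" if "p 0 < y" for y
      using above[of 0 y "q 0 + 1"] that by simp
  qed
  have "0 \<le> b"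
  proof (rule nonneg_slope)
    show "- (a * (p 0 + 1)) \<le> b * z" if "q 0 < z" for z
      using above[of 0 "p 0 + 1" z] that by simp
  qed
  have pos: "0 < a + b"
    using \<open>ab \<noteq> 0\<close> \<open>0 \<le> a\<close> \<open>0 \<le> b\<close> by (auto simp: zero_prod_def)
  show ?thesis
  proof
    show "0 \<le> a / (a + b)" "0 \<le> b / (a + b)"
      using \<open>0 \<le> a\<close> \<open>0 \<le> b\<close> by auto
    show "a / (a + b) + b / (a + b) = 1"
      using pos by (simp flip: add_divide_distrib)
    fix x
    have "a / (a + b) * p x + b / (a + b) * q x = (a * p x + b * q x) / (a + b)"
      by (simp add: add_divide_distrib)
    then show "0 \<le> a / (a + b) * p x + b / (a + b) * q x"
      using nonneg_comb[of x] pos by simp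
  qed
qed

lemma convex_on_Max:
  fixes F :: "'i \<Rightarrow> 'a::real_vector \<Rightarrow> real"
  assumes "finite I" "I \<noteq> {}" and F: "\<And>i. i \<in> I \<Longrightarrow> convex_on S (F i)"
  shows "convex_on S (\<lambda>x. Max ((\<lambda>i. F i x) ` I))"
proof (intro convex_on_def[THEN iffD2] conjI ballI allI impI)
  show "convex S" using assms convex_on_imp_convex by blast
  fix x y u v assume *: "x \<in> S" "y \<in> S" "(0::real) \<le> u" "(0::real) \<le> v" "u + v = 1"
  have "F i (u *\<^sub>R x + v *\<^sub>R y) \<le> u * Max ((\<lambda>i. F i x) ` I) + v * Max ((\<lambda>i. F i y) ` I)"
    if "i \<in> I" for i
  proof -
    have "F i (u *\<^sub>R x + v *\<^sub>R y) \<le> u * F i x + v * F i y"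
      using F[OF that] * by (auto simp: convex_on_def)
    also have "\<dots> \<le> u * Max ((\<lambda>i. F i x) ` I) + v * Max ((\<lambda>i. F i y) ` I)"
      using * that \<open>finite I\<close> by (intro add_mono mult_left_mono) auto
    finally show ?thesis .
  qed
  then show "Max ((\<lambda>i. F i (u *\<^sub>R x + v *\<^sub>R y)) ` I)
      \<le> u * Max ((\<lambda>i. F i x) ` I) + v * Max ((\<lambda>i. F i y) ` I)"
    using assms by auto
qed

text \<open>
  The induction peels off one function \<open>F i\<close>: the two-function case, applied to \<open>F i\<close> and the
  maximum of the others, yields weights \<open>s\<close>, \<open>t\<close> for which the family \<open>s * F i + t * F j\<close>
  again has nonnegative maximum.
\<close>
lemma Fan_alternative:
  fixes F :: "'i \<Rightarrow> 'a::real_vector \<Rightarrow> real"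
  assumes "finite I" "I \<noteq> {}" "\<And>i. i \<in> I \<Longrightarrow> convex_on UNIV (F i)"
    and "\<And>x. \<exists>i\<in>I. 0 \<le> F i x"
  shows "\<exists>\<alpha>. (\<forall>i\<in>I. 0 \<le> \<alpha> i) \<and> sum \<alpha> I = 1 \<and> (\<forall>x. 0 \<le> (\<Sum>i\<in>I. \<alpha> i * F i x))"
  using assms
proof (induction I arbitrary: F rule: finite_ne_induct)
  case (singleton i)
  then show ?case by (intro exI[of _ "\<lambda>_. 1"]) auto
next
  case (insert i I)
  define M where "M x = Max ((\<lambda>j. F j x) ` I)" for x
  have "convex_on UNIV M"
    unfolding M_def using insert by (intro convex_on_Max) auto
  moreover have "0 \<le> F i x \<or> 0 \<le> M x" for x
    using insert.prems(2)[of x] insert.hyps by (auto simp: M_def Max_ge_iff)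
  ultimately obtain s t where st: "0 \<le> s" "0 \<le> t" "s + t = 1" "\<And>x. 0 \<le> s * F i x + t * M x"
    using convex_alternative_two[of "F i" M] insert.prems(1) by blast
  have "convex_on UNIV (\<lambda>x. s * F i x + t * F j x)" if "j \<in> I" for j
    using that st insert.prems(1) by (intro convex_on_add convex_on_cmul) auto
  moreover have "\<exists>j\<in>I. 0 \<le> s * F i x + t * F j x" for x
  proof -
    \<comment> \<open>The maximum is attained at some \<open>j\<close>, for which
      \<open>F j x\<close> can replace \<open>M x\<close>.\<close>
    have "M x \<in> (\<lambda>j. F j x) ` I"
      unfolding M_def using insert.hyps by (intro Max_in) auto
    with st(4)[of x] show ?thesis by auto
  qed
  ultimately obtain l where l: "\<And>j. j \<in> I \<Longrightarrow> 0 \<le> l j" "sum l I = 1"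
    and pos: "\<And>x. 0 \<le> (\<Sum>j\<in>I. l j * (s * F i x + t * F j x))"
    using insert.IH[of "\<lambda>j x. s * F i x + t * F j x"] by blast
  \<comment> \<open>Since the \<open>l j\<close> sum to 1, expanding the combined sum leaves exactly
    \<open>s\<close> as the coefficient of \<open>F i\<close>.\<close>
  define \<alpha> where "\<alpha> j = (if j = i then s else t * l j)" for j
  have sum_I: "(\<Sum>j\<in>I. \<alpha> j * G j) = t * (\<Sum>j\<in>I. l j * G j)" for G
    unfolding sum_distrib_left using insert.hyps by (intro sum.cong) (auto simp: \<alpha>_def)
  have "(\<Sum>j\<in>insert i I. \<alpha> j * F j x) = (\<Sum>j\<in>I. l j * (s * F i x + t * F j x))" for x
  proof -
    have "(\<Sum>j\<in>I. l j * (s * F i x + t * F j x))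
        = sum l I * (s * F i x) + t * (\<Sum>j\<in>I. l j * F j x)"
      by (simp add: distrib_left sum.distrib sum_distrib_right sum_distrib_left mult_ac)
    then show ?thesis using insert.hyps l(2) sum_I[of "\<lambda>j. F j x"] by (simp add: \<alpha>_def)
  qed
  moreover have "sum \<alpha> (insert i I) = 1"
    using sum_I[of "\<lambda>_. 1"] insert.hyps l(2) st(3) by (simp add: \<alpha>_def)
  moreover have "\<forall>j\<in>insert i I. 0 \<le> \<alpha> j"
    using st l by (auto simp: \<alpha>_def)
  ultimately show ?case using pos by (intro exI[of _ \<alpha>]) auto
qed

section \<open>Optimality conditions\<close>

text \<open>Interval subtraction crosses the endpoints, so the lower function is paired with
  \<open>upper E\<close> and the upper function with \<open>lower E\<close>.\<close>

lemma weakly_quasi_LU_solution_iff: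
  "weakly_quasi_LU_solution E f X xs \<longleftrightarrow> xs \<in> X \<and>
    \<not> (\<exists>x\<in>X. lower (f x) - lower (f xs) + upper E * norm (x - xs) < 0 \<and>
             upper (f x) - upper (f xs) + lower E * norm (x - xs) < 0)"
proof -
  have "A \<prec>\<^sup>s\<^sub>L\<^sub>U B - interval_of (norm y) * E \<longleftrightarrow>
    lower A - lower B + upper E * norm y < 0 \<and> upper A - upper B + lower E * norm y < 0"
    for A B and y :: 'a
    by (auto simp: LU_sless_def lower_scale upper_scale algebra_simps)
  then show ?thesis by (simp add: weakly_quasi_LU_solution_def)
qed

lemma LU_less_imp:
  assumes "A \<prec>\<^sub>L\<^sub>U B - interval_of (norm y) * E"
  shows "lower A - lower B + upper E * norm y \<le> 0" "upper A - upper B + lower E * norm y \<le> 0"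
  using assms
  by (auto simp: LU_less_def LU_le_def lower_scale upper_scale
      algebra_simps)

lemma convex_feasible_set:
  fixes g :: "nat \<Rightarrow> 'a::real_vector \<Rightarrow> real"
  assumes "\<And>j. j \<in> {1..m} \<Longrightarrow> convex_on UNIV (g j)"
  shows "convex (feasible_set m g)"
proof (rule convexI)
  fix x y :: 'a and u v :: real
  assume *: "x \<in> feasible_set m g" "y \<in> feasible_set m g" "0 \<le> u" "0 \<le> v" "u + v = 1"
  have "g j (u *\<^sub>R x + v *\<^sub>R y) \<le> 0" if j: "j \<in> {1..m}" for j
    using convex_lower[OF assms[OF j] UNIV_I UNIV_I *(3-5), of x y] *(1,2) j
    by (force simp: feasible_set_def)
  then show "u *\<^sub>R x + v *\<^sub>R y \<in> feasible_set m g" by (simp add: feasible_set_def)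
qed

lemma strictly_convex_quasi_LU_solution:
  assumes L: "strictly_convex_on UNIV (\<lambda>x. lower (f x))"
    and U: "strictly_convex_on UNIV (\<lambda>x. upper (f x))"
    and "convex X" and weak: "weakly_quasi_LU_solution E f X xs"
  shows "quasi_LU_solution E f X xs"
proof -
  have "\<not> f x \<prec>\<^sub>L\<^sub>U f xs - interval_of (norm (x - xs)) * E" if "x \<in> X" for x
  proof
    assume less: "f x \<prec>\<^sub>L\<^sub>U f xs - interval_of (norm (x - xs)) * E"
    \<comment> \<open>At \<open>xs\<close> itself the perturbation vanishes, and
      \<open>LU_less\<close> is irreflexive. Strict convexity needs two distinct points.\<close>
    have "x \<noteq> xs"
    proof
      assume "x = xs"
      then have "f x = f xs - interval_of (norm (x - xs)) * E"
        by (simp add: interval_eq_iff lower_scale upper_scale)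
      with less show False by (simp add: LU_less_def)
    qed
    define z where "z = (1/2) *\<^sub>R x + (1/2) *\<^sub>R xs"
    have "z - xs = (1/2) *\<^sub>R (x - xs)"
      by (simp add: z_def algebra_simps flip: scaleR_left_distrib)
    then have norm_z: "norm (z - xs) = norm (x - xs) / 2" by simp
    have "h z < (1/2) * h x + (1/2) * h xs" if "strictly_convex_on UNIV h" for h
    proof -
      have "\<forall>u>0. \<forall>v>0. u + v = 1 \<longrightarrow> h (u *\<^sub>R x + v *\<^sub>R xs) < u * h x + v * h xs"
        using that \<open>x \<noteq> xs\<close> unfolding strictly_convex_on_def by blast
      then show ?thesis unfolding z_def by (rule allE[of _ "1/2"]) (auto dest: spec[of _ "1/2"])
    qed
    \<comment> \<open>At the midpoint the norm is exactly halved while both functions fall strictly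
      below their averages, so the weak inequalities at \<open>x\<close> become strict at
      \<open>z\<close>.\<close>
    from this[OF L] this[OF U] LU_less_imp[OF less]
    have "lower (f z) - lower (f xs) + upper E * norm (z - xs) < 0"
      "upper (f z) - upper (f xs) + lower E * norm (z - xs) < 0"
      by (simp_all add: norm_z)
    moreover have "z \<in> X"
      using \<open>convex X\<close> \<open>x \<in> X\<close> weak unfolding z_def
      by (intro convexD) (auto simp: weakly_quasi_LU_solution_def)
    ultimately show False using weak by (auto simp: weakly_quasi_LU_solution_iff)
  qed
  then show ?thesis
    using weak by (auto simp: quasi_LU_solution_def weakly_quasi_LU_solution_def)
qed

section \<open>Sufficiency of the multiplier conditions\<close>

lemma KKT_multipliers_imp_weakly_quasi_LU_solution:
  assumes "0 \<le> lower E" and xs: "xs \<in> feasible_set m g"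
    and KKT: "KKT_multipliers E f m g xs \<mu>L \<mu>U lam"
  shows "weakly_quasi_LU_solution E f (feasible_set m g) xs"
proof -
  define c where "c = \<mu>L * upper E + \<mu>U * lower E"
  have mu: "0 \<le> \<mu>L" "0 \<le> \<mu>U" "0 < \<mu>L + \<mu>U"
    and lam: "\<And>j. j \<in> {1..m} \<Longrightarrow> 0 \<le> lam j" "\<And>j. j \<in> {1..m} \<Longrightarrow> lam j * g j xs = 0"
    using KKT by (auto simp: KKT_multipliers_def)
  have "0 \<le> upper E" using \<open>0 \<le> lower E\<close> lower_le_upper[of E] by linarith
  then have "0 \<le> c" using mu \<open>0 \<le> lower E\<close> by (simp add: c_def)
  obtain v w s b where v: "v \<in> subdifferential (\<lambda>x. lower (f x)) xs"
    and w: "w \<in> subdifferential (\<lambda>x. upper (f x)) xs"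
    and s: "s \<in> (\<Sum>j=1..m. (*\<^sub>R) (lam j) ` subdifferential (g j) xs)"
    and b: "norm b \<le> 1" and zero: "\<mu>L *\<^sub>R v + \<mu>U *\<^sub>R w + s + c *\<^sub>R b = 0"
    using KKT unfolding KKT_multipliers_def c_def[symmetric]
    by (auto elim!: set_plus_elim)
  obtain r where r: "s = sum r {1..m}"
    "\<And>j. j \<in> {1..m} \<Longrightarrow> r j \<in> (*\<^sub>R) (lam j) ` subdifferential (g j) xs"
    using s by (auto simp: set_sum_alt)
  have "\<not> (lower (f x) - lower (f xs) + upper E * norm (x - xs) < 0 \<and>
           upper (f x) - upper (f xs) + lower E * norm (x - xs) < 0)"
    if x: "x \<in> feasible_set m g" for x
  proof
    assume neg: "lower (f x) - lower (f xs) + upper E * norm (x - xs) < 0 \<and>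
      upper (f x) - upper (f xs) + lower E * norm (x - xs) < 0"
    have r_le: "r j \<bullet> (x - xs) \<le> 0" if j: "j \<in> {1..m}" for j
    proof -
      obtain d where d: "r j = lam j *\<^sub>R d" "d \<in> subdifferential (g j) xs" using r(2)[OF j] by auto
      then have "r j \<bullet> (x - xs) \<le> lam j * (g j x - g j xs)"
        using lam(1)[OF j] by (auto simp: subdifferential_def intro: mult_left_mono)
      also have "\<dots> = lam j * g j x" using lam(2)[OF j] by (simp add: right_diff_distrib)
      also have "\<dots> \<le> 0" using lam(1)[OF j] x j by (auto simp: feasible_set_def mult_nonneg_nonpos)
      finally show ?thesis .
    qed
    have "s \<bullet> (x - xs) \<le> 0"
      unfolding r(1) inner_sum_left using r_le by (rule sum_nonpos)
    \<comment> \<open>By Cauchy-Schwarz the ball term costs at most the combined penalty, since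
      \<open>c\<close> weights \<open>upper E\<close> by \<open>\<mu>L\<close> and
      \<open>lower E\<close> by \<open>\<mu>U\<close>.\<close>
    moreover have "c * (b \<bullet> (x - xs)) \<le> c * norm (x - xs)"
    proof (intro mult_left_mono[OF _ \<open>0 \<le> c\<close>])
      have "b \<bullet> (x - xs) \<le> norm b * norm (x - xs)" by (rule norm_cauchy_schwarz)
      also have "\<dots> \<le> 1 * norm (x - xs)" using b by (intro mult_right_mono) auto
      finally show "b \<bullet> (x - xs) \<le> norm (x - xs)" by simp
    qed
    moreover have "\<mu>L * (v \<bullet> (x - xs)) \<le> \<mu>L * (lower (f x) - lower (f xs))"
      "\<mu>U * (w \<bullet> (x - xs)) \<le> \<mu>U * (upper (f x) - upper (f xs))"
      using v w mu by (auto simp: subdifferential_def intro!: mult_left_mono)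
    moreover have "\<mu>L * (v \<bullet> (x - xs)) + \<mu>U * (w \<bullet> (x - xs)) + s \<bullet> (x - xs)
        + c * (b \<bullet> (x - xs)) = 0"
      using arg_cong[OF zero, of "\<lambda>y. y \<bullet> (x - xs)"] by (simp add: inner_add_left)
    ultimately have "0 \<le> \<mu>L * (lower (f x) - lower (f xs) + upper E * norm (x - xs))
        + \<mu>U * (upper (f x) - upper (f xs) + lower E * norm (x - xs))"
      by (simp add: c_def algebra_simps)
    moreover have "\<mu>L * a + \<mu>U * b < 0" if "a < 0" "b < 0" for a b
      using mu that by (cases "\<mu>L = 0") (auto intro!: add_neg_nonpos mult_pos_neg mult_nonneg_nonpos)
    ultimately show False using neg by (meson not_less)
  qed
  with xs show ?thesis by (auto simp: weakly_quasi_LU_solution_iff)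
qed

section \<open>Necessity of the multiplier conditions under MFCQ\<close>

lemma weakly_quasi_LU_solution_imp_KKT_multipliers:
  fixes f :: "'a::euclidean_space \<Rightarrow> real interval" and g :: "nat \<Rightarrow> 'a \<Rightarrow> real"
  assumes fL: "convex_on UNIV (\<lambda>x. lower (f x))" and fU: "convex_on UNIV (\<lambda>x. upper (f x))"
    and g: "\<And>j. j \<in> {1..m} \<Longrightarrow> convex_on UNIV (g j)" and "0 \<le> lower E"
    and mfcq: "MFCQ m g xs"
    and weak: "weakly_quasi_LU_solution E f (feasible_set m g) xs"
  obtains \<mu>L \<mu>U lam where "KKT_multipliers E f m g xs \<mu>L \<mu>U lam"
proof -
  have "0 \<le> upper E" using \<open>0 \<le> lower E\<close> lower_le_upper[of E] by linarith
  have norm_convex: "convex_on UNIV (\<lambda>x. norm (x - xs))"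
    using convex_on_dist[of UNIV xs] by (simp add: dist_norm norm_minus_commute)
  define \<phi>L where "\<phi>L x = lower (f x) - lower (f xs) + upper E * norm (x - xs)" for x
  define \<phi>U where "\<phi>U x = upper (f x) - upper (f xs) + lower E * norm (x - xs)" for x
  \<comment> \<open>The constraints occupy the indices 1 to \<open>m\<close>, so 0 and
    \<open>Suc m\<close> are free for the two objectives.\<close>
  define F where "F i = (if i = 0 then \<phi>L else if i = Suc m then \<phi>U else g i)" for i
  have perturbed: "convex_on UNIV (\<lambda>x. h x - a + e * norm (x - xs))"
    if "convex_on UNIV h" "0 \<le> e" for h a e
  proof -
    have "convex_on UNIV (\<lambda>x. h x + - a)"
      using that by (intro convex_on_add) (auto simp: convex_on_const)
    then show ?thesis using that norm_convex by auto
  qed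
  have "convex_on UNIV \<phi>L" "convex_on UNIV \<phi>U"
    unfolding \<phi>L_def \<phi>U_def
    using fL fU \<open>0 \<le> upper E\<close> \<open>0 \<le> lower E\<close> by (auto intro: perturbed)
  then have "convex_on UNIV (F i)" if "i \<in> {0..Suc m}" for i
    using that g by (auto simp: F_def)
  moreover have "\<exists>i\<in>{0..Suc m}. 0 \<le> F i x" for x
  proof (rule ccontr)
    assume "\<not> (\<exists>i\<in>{0..Suc m}. 0 \<le> F i x)"
    then have neg: "F i x < 0" if "i \<le> Suc m" for i using that by (auto simp: not_le)
    have "g j x \<le> 0" if "j \<in> {1..m}" for j
      using neg[of j] that by (simp add: F_def split: if_splits)
    then have "x \<in> feasible_set m g" by (simp add: feasible_set_def)
    moreover have "\<phi>L x < 0" "\<phi>U x < 0"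
      using neg[of 0] neg[of "Suc m"] by (simp_all add: F_def)
    ultimately show False
      using weak by (auto simp: weakly_quasi_LU_solution_iff \<phi>L_def \<phi>U_def)
  qed
  ultimately have "\<exists>l. (\<forall>i\<in>{0..Suc m}. 0 \<le> l i) \<and> sum l {0..Suc m} = 1 \<and>
      (\<forall>x. 0 \<le> (\<Sum>i=0..Suc m. l i * F i x))"
    by (intro Fan_alternative) auto
  then obtain l where l: "\<And>i. i \<in> {0..Suc m} \<Longrightarrow> 0 \<le> l i" "sum l {0..Suc m} = 1"
    and nonneg: "\<And>x. 0 \<le> (\<Sum>i=0..Suc m. l i * F i x)"
    by blast
  define \<mu>L \<mu>U where "\<mu>L = l 0" and "\<mu>U = l (Suc m)"
  have mu: "0 \<le> \<mu>L" "0 \<le> \<mu>U" using l(1) by (auto simp: \<mu>L_def \<mu>U_def)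
  have split: "(\<Sum>i=0..Suc m. h i) = h 0 + h (Suc m) + (\<Sum>j=1..m. h j)" for h :: "nat \<Rightarrow> real"
    by (simp add: sum.atLeast_Suc_atMost[of 0 m])
  have Lagrange: "0 \<le> \<mu>L * \<phi>L x + \<mu>U * \<phi>U x + (\<Sum>j=1..m. l j * g j x)" for x
  proof -
    have "(\<Sum>j=1..m. l j * F j x) = (\<Sum>j=1..m. l j * g j x)"
      by (intro sum.cong) (auto simp: F_def)
    with nonneg[of x] show ?thesis unfolding split by (simp add: F_def \<mu>L_def \<mu>U_def)
  qed
  have g_le: "g j xs \<le> 0" if "j \<in> {1..m}" for j
    using that weak by (auto simp: weakly_quasi_LU_solution_def feasible_set_def)
  have slack: "l j * g j xs = 0" if "j \<in> {1..m}" for j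
  proof -
    have nonpos: "l j * g j xs \<le> 0" if "j \<in> {1..m}" for j
      using g_le[OF that] l(1)[of j] that by (auto simp: mult_nonneg_nonpos)
    \<comment> \<open>Both objectives vanish at \<open>xs\<close>. A sum of nonpositive terms that
      is nonnegative has only zero terms.\<close>
    have "0 \<le> (\<Sum>j=1..m. l j * g j xs)"
      using Lagrange[of xs] by (simp add: \<phi>L_def \<phi>U_def)
    moreover have "(\<Sum>j=1..m. l j * g j xs) \<le> 0"
      using nonpos by (rule sum_nonpos)
    ultimately have "(\<Sum>j=1..m. - (l j * g j xs)) = 0"
      unfolding sum_negf by linarith
    then show ?thesis
      using sum_nonneg_eq_0_iff[of "{1..m}" "\<lambda>j. - (l j * g j xs)"] nonpos that by auto
  qed
  define c where "c = \<mu>L * upper E + \<mu>U * lower E"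
  have "0 \<le> c" using mu \<open>0 \<le> upper E\<close> \<open>0 \<le> lower E\<close> by (simp add: c_def)
  define sumg where "sumg x = (\<Sum>j=1..m. l j * g j x)" for x
  have cvx_lg: "convex_on UNIV (\<lambda>x. l j * g j x)" if "j \<in> {1..m}" for j
    using that g l(1)[of j] by (intro convex_on_cmul) auto
  then have cvx_sumg: "convex_on UNIV sumg"
    unfolding sumg_def by (intro convex_on_sum_functions) auto
  have subd_sumg:
    "subdifferential sumg xs \<subseteq> (\<Sum>j=1..m. (*\<^sub>R) (l j) ` subdifferential (g j) xs)"
  proof -
    have "subdifferential sumg xs \<subseteq> (\<Sum>j=1..m. subdifferential (\<lambda>x. l j * g j x) xs)"
      unfolding sumg_def using cvx_lg by (intro subdifferential_sum_subset) auto
    also have "\<dots> \<subseteq> (\<Sum>j=1..m. (*\<^sub>R) (l j) ` subdifferential (g j) xs)"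
    proof
      fix v assume "v \<in> (\<Sum>j=1..m. subdifferential (\<lambda>x. l j * g j x) xs)"
      then obtain r where r: "v = sum r {1..m}"
        "\<And>j. j \<in> {1..m} \<Longrightarrow> r j \<in> subdifferential (\<lambda>x. l j * g j x) xs"
        by (auto simp: set_sum_alt)
      have "r j \<in> (*\<^sub>R) (l j) ` subdifferential (g j) xs" if "j \<in> {1..m}" for j
        using r(2)[OF that] subdifferential_cmult_subset[OF g, of j "l j" xs] l(1)[of j] that
        by auto
      with r(1) show "v \<in> (\<Sum>j=1..m. (*\<^sub>R) (l j) ` subdifferential (g j) xs)"
        by (auto simp: set_sum_alt)
    qed
    finally show ?thesis .
  qed
  let ?sL = "\<lambda>x. \<mu>L * lower (f x)" and ?sU = "\<lambda>x. \<mu>U * upper (f x)"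
    and ?n = "\<lambda>x. c * norm (x - xs)"
  have cvx: "convex_on UNIV ?sL" "convex_on UNIV ?sU" "convex_on UNIV ?n"
    using fL fU norm_convex mu \<open>0 \<le> c\<close> by auto
  have "sumg xs = 0" unfolding sumg_def using slack by (intro sum.neutral) auto
  \<comment> \<open>By \<open>Lagrange\<close>, \<open>xs\<close> is a global minimiser of this sum,
    in which the two norm penalties are merged into one with coefficient \<open>c\<close>.\<close>
  have "0 \<in> subdifferential (\<lambda>x. ?sL x + ?sU x + sumg x + ?n x) xs"
    unfolding subdifferential_def using Lagrange \<open>sumg xs = 0\<close>
    by (auto simp: \<phi>L_def \<phi>U_def c_def sumg_def algebra_simps)
  also have "\<dots> \<subseteq> subdifferential (\<lambda>x. ?sL x + ?sU x + sumg x) xs + subdifferential ?n xs"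
    by (intro subdifferential_add_subset convex_on_add cvx cvx_sumg)
  also have "\<dots> \<subseteq> subdifferential (\<lambda>x. ?sL x + ?sU x) xs + subdifferential sumg xs
      + subdifferential ?n xs"
    by (intro set_plus_mono2 order_refl subdifferential_add_subset convex_on_add cvx cvx_sumg)
  also have "\<dots> \<subseteq> subdifferential ?sL xs + subdifferential ?sU xs + subdifferential sumg xs
      + subdifferential ?n xs"
    by (intro set_plus_mono2 order_refl subdifferential_add_subset cvx)
  also have "\<dots> \<subseteq> (*\<^sub>R) \<mu>L ` subdifferential (\<lambda>x. lower (f x)) xs
      + (*\<^sub>R) \<mu>U ` subdifferential (\<lambda>x. upper (f x)) xs
      + (\<Sum>j=1..m. (*\<^sub>R) (l j) ` subdifferential (g j) xs) + (*\<^sub>R) c ` cball 0 1"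
    using mu \<open>0 \<le> c\<close> fL fU
    by (intro set_plus_mono2 subdifferential_cmult_subset subd_sumg subdifferential_norm_subset)
  finally have incl: "0 \<in> (*\<^sub>R) \<mu>L ` subdifferential (\<lambda>x. lower (f x)) xs
      + (*\<^sub>R) \<mu>U ` subdifferential (\<lambda>x. upper (f x)) xs
      + (\<Sum>j=1..m. (*\<^sub>R) (l j) ` subdifferential (g j) xs) + (*\<^sub>R) c ` cball 0 1" .
  have "0 < \<mu>L + \<mu>U"
  proof (rule ccontr)
    assume "\<not> 0 < \<mu>L + \<mu>U"
    with mu have zero: "\<mu>L = 0" "\<mu>U = 0" by linarith+
    then have "c = 0" by (simp add: c_def)
    have "0 \<in> (\<Sum>j=1..m. (*\<^sub>R) (l j) ` subdifferential (g j) xs)"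
      using incl unfolding zero \<open>c = 0\<close> by (auto elim!: set_plus_elim)
    then obtain r where r: "0 = sum r {1..m}"
      "\<And>j. j \<in> {1..m} \<Longrightarrow> r j \<in> (*\<^sub>R) (l j) ` subdifferential (g j) xs"
      by (auto simp: set_sum_alt)
    let ?A = "active_indices m g xs"
    have A: "?A \<subseteq> {1..m}" "finite ?A" by (auto simp: active_indices_def)
    have inactive: "l j = 0" if "j \<in> {1..m} - ?A" for j
      using slack[of j] that by (auto simp: active_indices_def)
    \<comment> \<open>Slackness makes inactive multipliers zero, so their summands vanish and the
      inclusion restricts to the active indices, as \<open>MFCQ\<close> requires.\<close>
    then have "r j = 0" if "j \<in> {1..m} - ?A" for j using r(2)[of j] that by auto
    then have "0 = sum r ?A"
      using r(1) A sum.mono_neutral_left[of "{1..m}" ?A r] by auto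
    then have "0 \<in> (\<Sum>j\<in>?A. (*\<^sub>R) (l j) ` subdifferential (g j) xs)"
      using r(2) A unfolding set_sum_alt[OF A(2)] by blast
    \<comment> \<open>The weights sum to 1, and neither the objectives nor the inactive constraints
      carry any of it.\<close>
    moreover have "\<exists>j\<in>?A. l j \<noteq> 0"
    proof (rule ccontr)
      assume "\<not> (\<exists>j\<in>?A. l j \<noteq> 0)"
      with inactive have "\<forall>j\<in>{1..m}. l j = 0" by auto
      with l(2) zero show False unfolding split by (simp add: \<mu>L_def \<mu>U_def)
    qed
    moreover have "\<forall>j\<in>?A. 0 \<le> l j" using l(1) A by auto
    ultimately show False using mfcq unfolding MFCQ_def by blast
  qed
  then have "KKT_multipliers E f m g xs \<mu>L \<mu>U l"
    using mu l(1) incl slack by (auto simp: KKT_multipliers_def c_def)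
  then show ?thesis by (rule that)
qed

theorem theorem4p4:
  fixes f :: "real ^ 'n \<Rightarrow> real interval"
    and g :: "nat \<Rightarrow> real ^ 'n \<Rightarrow> real"
    and m :: nat
    and E :: "real interval"
    and xs :: "real ^ 'n"
  assumes "convex_on UNIV (\<lambda>x. lower (f x))"
    and "convex_on UNIV (\<lambda>x. upper (f x))"
    and "\<And>j. j \<in> {1..m} \<Longrightarrow> convex_on UNIV (g j)"
    and "0 \<le> lower E"
    and "xs \<in> feasible_set m g"
    and "MFCQ m g xs"
  shows "(weakly_quasi_LU_solution E f (feasible_set m g) xs \<longleftrightarrow>
           (\<exists>\<mu>L \<mu>U lam. KKT_multipliers E f m g xs \<mu>L \<mu>U lam)) \<and>
         (strictly_convex_on UNIV (\<lambda>x. lower (f x)) \<and>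
          strictly_convex_on UNIV (\<lambda>x. upper (f x)) \<and>
          (\<exists>\<mu>L \<mu>U lam. KKT_multipliers E f m g xs \<mu>L \<mu>U lam) \<longrightarrow>
           quasi_LU_solution E f (feasible_set m g) xs)"
proof -
  have "weakly_quasi_LU_solution E f (feasible_set m g) xs \<longleftrightarrow>
      (\<exists>\<mu>L \<mu>U lam. KKT_multipliers E f m g xs \<mu>L \<mu>U lam)"
  proof
    assume "weakly_quasi_LU_solution E f (feasible_set m g) xs"
    from assms(1-4,6) this obtain \<mu>L \<mu>U lam where "KKT_multipliers E f m g xs \<mu>L \<mu>U lam"
      by (rule weakly_quasi_LU_solution_imp_KKT_multipliers[where m = m and g = g])
    then show "\<exists>\<mu>L \<mu>U lam. KKT_multipliers E f m g xs \<mu>L \<mu>U lam" by blast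
  next
    assume "\<exists>\<mu>L \<mu>U lam. KKT_multipliers E f m g xs \<mu>L \<mu>U lam"
    with assms(4,5) show "weakly_quasi_LU_solution E f (feasible_set m g) xs"
      by (auto intro: KKT_multipliers_imp_weakly_quasi_LU_solution)
  qed
  \<comment> \<open>The strictly convex case goes through the equivalence: multipliers give weak
    optimality, which is then strengthened.\<close>
  moreover have "quasi_LU_solution E f (feasible_set m g) xs"
    if "strictly_convex_on UNIV (\<lambda>x. lower (f x))" "strictly_convex_on UNIV (\<lambda>x. upper (f x))"
      "weakly_quasi_LU_solution E f (feasible_set m g) xs"
    using that(1,2) convex_feasible_set[OF assms(3)] that(3)
    by (rule strictly_convex_quasi_LU_solution)
  ultimately show ?thesis by blast
qed

end
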